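(* Let $t,k,v$ be integers with $0<t<k<v$, and for $0 \le i \le t$ put $s_i = 2^{t+1}-2^{t-i}$. For every $i \in \{0,1,\ldots,t-1\}$ and every integer $s$ with $s_i < s < s_{i+1}$ (that is, $2^{t+1}-2^{t-i} < s < 2^{t+1}-2^{t-i-1}$), there does not exist any Steiner $t$-$(v,k)$ trade of volume $s$.
   Context: Let $0<t<k<v$ be natural numbers and let $X$ be a set with $v$ elements. For $0 \le j \le v$, $P_j(X)$ denotes the set of all $j$-element subsets of $X$; elements of $P_k(X)$ are called blocks. A $t$-$(v,k)$ trade $T=\{T_1,T_2\}$ consists of two disjoint collections $T_1,T_2$ of blocks (repeated blocks within $T_1$ or within $T_2$ are allowed in general, i.e. they are finite multisets with no common block) such that every element of $P_t(X)$ is contained in the same number of blocks of $T_1$ as of $T_2$ (counted with multiplicity). Then $|T_1|=|T_2|$, and this common number is called the volume of $T$. A $t$-$(v,k)$ trade is called a Steiner $t$-$(v,k)$ trade if every element of $P_t(X)$ is contained in at most one block of $T_1$ and in at most one block of $T_2$. *)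

theory Defs
  imports Main "HOL-Library.Multiset" "HOL-Library.Ramsey"
begin

text \<open>
  The set \<open>P_j(X)\<close> of all \<open>j\<close>-element subsets of \<open>X\<close> is \<^term>\<open>nsets X j\<close>.
  A trade \<open>{T\<^sub>1, T\<^sub>2}\<close> is encoded as an ordered pair of multisets of blocks; every notion below
  is invariant under swapping the components.
\<close>

definition cover_count :: "'a set multiset \<Rightarrow> 'a set \<Rightarrow> nat" where
  "cover_count M A = size (filter_mset (\<lambda>B. A \<subseteq> B) M)"

definition trade :: "nat \<Rightarrow> nat \<Rightarrow> 'a set \<Rightarrow> 'a set multiset \<times> 'a set multiset \<Rightarrow> bool" where
  "trade t k X T \<longleftrightarrow>
     set_mset (fst T) \<subseteq> nsets X k \<and>
     set_mset (snd T) \<subseteq> nsets X k \<and>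
     set_mset (fst T) \<inter> set_mset (snd T) = {} \<and>
     (\<forall>A \<in> nsets X t. cover_count (fst T) A = cover_count (snd T) A)"

definition steiner_trade :: "nat \<Rightarrow> nat \<Rightarrow> 'a set \<Rightarrow> 'a set multiset \<times> 'a set multiset \<Rightarrow> bool" where
  "steiner_trade t k X T \<longleftrightarrow>
     trade t k X T \<and>
     (\<forall>A \<in> nsets X t. cover_count (fst T) A \<le> 1 \<and> cover_count (snd T) A \<le> 1)"

text \<open>The choice of component is immaterial, see \<open>trade_size_eq\<close> below.\<close>

definition volume :: "'a set multiset \<times> 'a set multiset \<Rightarrow> nat" where
  "volume T = size (fst T)"

lemma sum_cover_count:
  assumes "finite X" "set_mset M \<subseteq> nsets X k"
  shows "(\<Sum>A\<in>nsets X t. cover_count M A) = size M * (k choose t)"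
  using assms(2)
proof (induction M)
  case empty
  then show ?case by (simp add: cover_count_def)
next
  case (add B M)
  have fin: "finite (nsets X t)" using assms(1) by (simp add: finite_imp_finite_nsets)
  have B: "B \<subseteq> X" "finite B" "card B = k" using add.prems by (auto simp: nsets_def)
  have "{A \<in> nsets X t. A \<subseteq> B} = {A. A \<subseteq> B \<and> card A = t}"
    using B by (auto simp: nsets_def intro: finite_subset)
  then have c: "card {A \<in> nsets X t. A \<subseteq> B} = k choose t"
    using B n_subsets by metis
  have "cover_count (add_mset B M) A = (if A \<subseteq> B then 1 else 0) + cover_count M A" for A
    by (simp add: cover_count_def)
  then have "(\<Sum>A\<in>nsets X t. cover_count (add_mset B M) A)
      = (\<Sum>A\<in>nsets X t. if A \<subseteq> B then 1 else 0) + size M * (k choose t)"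
    using add by (simp add: sum.distrib)
  also have "(\<Sum>A\<in>nsets X t. if A \<subseteq> B then 1 else 0) = card {A \<in> nsets X t. A \<subseteq> B}"
    using fin by (simp add: sum.If_cases Int_def)
  finally show ?case using c by simp
qed

lemma trade_size_eq:
  assumes "finite X" "t \<le> k" "trade t k X T"
  shows "size (fst T) = size (snd T)"
proof -
  have "size (fst T) * (k choose t) = size (snd T) * (k choose t)"
    using assms sum_cover_count[of X "fst T" k t] sum_cover_count[of X "snd T" k t]
    by (auto simp: trade_def)
  then show ?thesis using assms(2) by simp
qed

end

(*
  Let S be the union of the two sides of the trade and n = t + 1. Every set of fewer than n points
  lies in an even number of members of S, i.e. S is a Reed-Muller codeword of minimum distance 2^n,
  and we need that |S| < 2^(n+1) forces |S| = 2^(n+1) - 2^j (Kasami-Tokura).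
  Argue by induction on n. Put e = 2^(n+1) - |S|, supposed not to be a power of 2, and let g(A) be
  the sum over B in S of (-1)^|A Int B|. Cutting S by a character lowers n by one, so the
  induction hypothesis gives |g(A)| = 2^a - e > 0 unless the character is constant on S.
  If g(A) g(C) g(A+C) < 0 for three nonconstant characters, one quarter of S has
  2^(n+1) + 2e - (2^a + 2^b + 2^c) as four times its size, and the induction hypothesis for n - 2
  makes 2^a + 2^b + 2^c - 2e a power of 2; as all of 2^a, 2^b, 2^c exceed e, e is a power of 2.
  So A |-> sgn g(A) is itself a character, and by orthogonality the sum of all |g(A)| is at most
  2^|X|. But every |g(A)| is at least 1, and g({}) = |S| > 1.
*)
theory Submission
  imports Defs
begin

section \<open>Characters of the group of subsets under symmetric difference, and the pieces they
  cut out of an even cover\<close>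

definition walsh :: "'a set \<Rightarrow> 'a set \<Rightarrow> int" where
  "walsh A B = (- 1) ^ card (A \<inter> B)"

text \<open>
  Identifying sets with 0/1-vectors, this is membership in the Reed--Muller code of order
  \<open>card X - n\<close>, whose minimum distance is \<open>2 ^ n\<close>.
\<close>

definition even_cover :: "nat \<Rightarrow> 'a set \<Rightarrow> 'a set set \<Rightarrow> bool" where
  "even_cover n X S \<longleftrightarrow> (\<forall>A\<subseteq>X. card A < n \<longrightarrow> even (card {B \<in> S. A \<subseteq> B}))"

lemma walsh_empty [simp]: "walsh {} B = 1"
  by (simp add: walsh_def)

lemma walsh_cases: "walsh A B = 1 \<or> walsh A B = - 1"
  by (cases "even (card (A \<inter> B))") (simp_all add: walsh_def)

lemma walsh_singleton: "walsh {x} B = (if x \<in> B then - 1 else 1)"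
  by (simp add: walsh_def)

lemma walsh_sym_diff:
  assumes "finite A" "finite C"
  shows "walsh (sym_diff A C) B = walsh A B * walsh C B"
proof -
  have "card (A \<inter> B) = card ((A - C) \<inter> B) + card (A \<inter> C \<inter> B)"
    using assms by (subst card_Un_disjoint [symmetric]) (auto intro!: arg_cong [where f = card])
  moreover have "card (C \<inter> B) = card ((C - A) \<inter> B) + card (A \<inter> C \<inter> B)"
    using assms by (subst card_Un_disjoint [symmetric]) (auto intro!: arg_cong [where f = card])
  moreover have "card (sym_diff A C \<inter> B) = card ((A - C) \<inter> B) + card ((C - A) \<inter> B)"
    using assms by (subst card_Un_disjoint [symmetric]) (auto intro!: arg_cong [where f = card])
  ultimately have "card (A \<inter> B) + card (C \<inter> B) = card (sym_diff A C \<inter> B) + 2 * card (A \<inter> C \<inter> B)"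
    by simp
  then have "(- 1 :: int) ^ (card (A \<inter> B) + card (C \<inter> B)) = (- 1) ^ card (sym_diff A C \<inter> B)"
    by (simp only: power_add power_mult) simp
  then show ?thesis by (simp add: walsh_def power_add)
qed

text \<open>Double counting: for each \<open>x\<close> in \<open>A\<close>, evenly many members of
  \<open>S\<close> contain \<open>insert x C\<close>, so the sum of
  \<open>card (A \<inter> B)\<close> over the members \<open>B\<close> containing \<open>C\<close>
  is even, and hence evenly many of these \<open>B\<close> meet \<open>A\<close> in an odd number of
  points. The extra point \<open>x\<close> is what costs one in \<open>n\<close>.\<close>

lemma even_cover_half:
  assumes "finite X" "finite S" "A \<subseteq> X" "even_cover (Suc n) X S" "c = 1 \<or> c = - 1"
  shows "even_cover n X {B \<in> S. walsh A B = c}"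
  unfolding even_cover_def
proof (intro allI impI)
  fix C assume C: "C \<subseteq> X" "card C < n"
  define S' where "S' = {B \<in> S. C \<subseteq> B}"
  have fin: "finite S'" "finite A" "finite C"
    using assms C by (auto simp: S'_def intro: finite_subset)
  have "even (card {B \<in> S'. x \<in> B})" if "x \<in> A" for x
  proof -
    have "{B \<in> S'. x \<in> B} = {B \<in> S. insert x C \<subseteq> B}" by (auto simp: S'_def)
    moreover have "card (insert x C) < Suc n"
      using C fin by (simp add: card_insert_if)
    ultimately show ?thesis
      using assms(3,4) that C unfolding even_cover_def by (metis insert_subset subsetD)
  qed
  then have "even (\<Sum>x\<in>A. card {B \<in> S'. x \<in> B})" by (simp add: dvd_sum)
  also have "(\<Sum>x\<in>A. card {B \<in> S'. x \<in> B}) = (\<Sum>B\<in>S'. card {x \<in> A. x \<in> B})"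
    by (rule sum_multicount_gen) (use fin in auto)
  also have "\<dots> = (\<Sum>B\<in>S'. card (A \<inter> B))" by (simp add: Int_def)
  finally have odd_part: "even (card {B \<in> S'. odd (card (A \<inter> B))})"
    using fin by (simp add: even_sum_iff)
  have "even (card S')"
    using assms(4) C by (auto simp: even_cover_def S'_def)
  moreover have "card S' = card {B \<in> S'. even (card (A \<inter> B))} + card {B \<in> S'. odd (card (A \<inter> B))}"
    using fin by (subst card_Un_disjoint [symmetric]) (auto intro!: arg_cong [where f = card])
  ultimately have "even (card {B \<in> S'. even (card (A \<inter> B))})" using odd_part by simp
  moreover have "{B \<in> {B \<in> S. walsh A B = c}. C \<subseteq> B} = {B \<in> S'. even (card (A \<inter> B)) \<longleftrightarrow> c = 1}"
    using assms(5) by (auto simp: S'_def walsh_def minus_one_power_iff)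
  ultimately show "even (card {B \<in> {B \<in> S. walsh A B = c}. C \<subseteq> B})"
    using odd_part by (cases "c = 1") auto
qed

lemma card_walsh_half:
  assumes "finite S" "c = 1 \<or> c = - 1"
  shows "2 * int (card {B \<in> S. walsh A B = c}) = int (card S) + c * (\<Sum>B\<in>S. walsh A B)"
proof -
  have "(\<Sum>B\<in>S. 1 + c * walsh A B) = (\<Sum>B\<in>S. if walsh A B = c then 2 else 0)"
    using assms(2) walsh_cases[of A] by (intro sum.cong) (auto, force+)
  also have "\<dots> = 2 * int (card {B \<in> S. walsh A B = c})"
    using assms(1) by (simp add: sum.If_cases Int_def)
  finally show ?thesis by (simp add: sum.distrib sum_distrib_left)
qed

text \<open>The product \<open>(1 + c * walsh A B) * (1 + c' * walsh A' B)\<close> is 4 on the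
  quarter and 0 off it; expanding it produces the character of the symmetric difference.\<close>

lemma card_walsh_quarter:
  assumes "finite S" "c = 1 \<or> c = - 1" "c' = 1 \<or> c' = - 1" "finite A" "finite A'"
  shows "4 * int (card {B \<in> {B \<in> S. walsh A B = c}. walsh A' B = c'}) =
    int (card S) + c * (\<Sum>B\<in>S. walsh A B) + c' * (\<Sum>B\<in>S. walsh A' B)
      + c * c' * (\<Sum>B\<in>S. walsh (sym_diff A A') B)"
proof -
  have "(\<Sum>B\<in>S. 1 + c * walsh A B + c' * walsh A' B + c * c' * walsh (sym_diff A A') B)
      = (\<Sum>B\<in>S. if walsh A B = c \<and> walsh A' B = c' then 4 else 0)"
  proof (rule sum.cong)
    fix B
    show "1 + c * walsh A B + c' * walsh A' B + c * c' * walsh (sym_diff A A') B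
        = (if walsh A B = c \<and> walsh A' B = c' then 4 else 0)"
      using assms(2,3) walsh_cases[of A B] walsh_cases[of A' B]
      by (simp only: walsh_sym_diff[OF assms(4,5)]) (elim disjE; simp)
  qed simp
  also have "\<dots> = 4 * int (card {B \<in> S. walsh A B = c \<and> walsh A' B = c'})"
    using assms(1) by (simp add: sum.If_cases Int_def)
  finally show ?thesis by (simp add: sum.distrib sum_distrib_left conj_ac)
qed

text \<open>Let \<open>2 ^ x\<close> be the least of the three powers. From \<open>e < 2 ^ x\<close>
  follows \<open>2 ^ x < 2 ^ l\<close>, so \<open>2 ^ x\<close> divides all four powers and hence
  \<open>2 * e\<close>. As \<open>0 < 2 * e < 2 * 2 ^ x\<close>, this forces
  \<open>2 * e = 2 ^ x\<close>.\<close>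

lemma power_two_sum_three:
  fixes e :: int and a b c l :: nat
  assumes "0 < e" "e < 2 ^ a" "e < 2 ^ b" "e < 2 ^ c" "2 ^ a + 2 ^ b + 2 ^ c = 2 * e + 2 ^ l"
  shows "\<exists>j < max a (max b c). e = 2 ^ j"
proof -
  have *: "\<exists>j<x. e = 2 ^ j"
    if "e < 2 ^ x" "x \<le> y" "x \<le> z" "2 ^ x + 2 ^ y + 2 ^ z = 2 * e + (2::int) ^ l" for x y z
  proof -
    have le: "(2::int) ^ x \<le> 2 ^ y" "(2::int) ^ x \<le> 2 ^ z"
      using that by auto
    then have "(2::int) ^ x < 2 ^ l" using that(1,4) by linarith
    then have "x \<le> l" by simp
    have eq: "2 * e = 2 ^ x + 2 ^ y + 2 ^ z - (2::int) ^ l" using that by simp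
    have "(2::int) ^ x dvd 2 * e"
      unfolding eq using that \<open>x \<le> l\<close> by (intro dvd_diff dvd_add le_imp_power_dvd) auto
    then obtain q where q: "2 * e = 2 ^ x * q" by (elim dvdE)
    have "0 < 2 ^ x * q" "2 ^ x * q < 2 ^ x * 2"
      using q assms(1) that(1) by linarith+
    then have "q = 1"
      by (simp add: zero_less_mult_iff)
    then have e2: "2 * e = 2 ^ x" using q by simp
    then have "x \<noteq> 0" by (metis power_0 odd_one dvd_triv_left)
    then obtain j where "x = Suc j" by (cases x) auto
    then show ?thesis using e2 by auto
  qed
  consider "a \<le> b" "a \<le> c" | "b \<le> a" "b \<le> c" | "c \<le> a" "c \<le> b" by linarith
  then show ?thesis
  proof cases
    case 1
    then show ?thesis using *[of a b c] assms by auto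
  next
    case 2
    then show ?thesis using *[of b a c] assms by (auto simp: add_ac)
  next
    case 3
    then show ?thesis using *[of c a b] assms by (auto simp: add_ac)
  qed
qed

section \<open>Orthogonality, and absolute values and signs of character sums\<close>

text \<open>Translation by \<open>C\<close> permutes \<open>Pow X\<close> and negates
  \<open>f\<close>, so the sum equals its own negative.\<close>

lemma sum_character_Pow_eq_0:
  fixes f :: "'a set \<Rightarrow> int"
  assumes mult: "\<And>A C. A \<subseteq> X \<Longrightarrow> C \<subseteq> X \<Longrightarrow> f (sym_diff A C) = f A * f C"
    and C: "C \<subseteq> X" "f C = - 1"
  shows "(\<Sum>A\<in>Pow X. f A) = 0"
proof -
  have "(\<Sum>A\<in>Pow X. f A) = (\<Sum>A\<in>Pow X. - f A)"
  proof (rule sum.reindex_bij_witness[where i = "\<lambda>A. sym_diff A C" and j = "\<lambda>A. sym_diff A C"])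
    fix A assume "A \<in> Pow X"
    then show "- f (sym_diff A C) = f A" using mult[of A C] C by simp
  qed (use C in auto)
  then show ?thesis by (simp add: sum_negf)
qed

lemma abs_sum_walsh_dichotomy:
  assumes fin: "finite X" "S \<subseteq> Pow X" and even: "even_cover (Suc m) X S"
    and small: "card S < 2 ^ Suc (Suc m)"
    and e: "e = 2 ^ Suc (Suc m) - int (card S)" "\<And>j. j \<le> Suc m \<Longrightarrow> e \<noteq> 2 ^ j"
    and IH: "\<And>H. H \<subseteq> S \<Longrightarrow> even_cover m X H \<Longrightarrow> H \<noteq> {} \<Longrightarrow> card H < 2 ^ Suc m
      \<Longrightarrow> \<exists>j\<le>m. int (card H) = 2 ^ Suc m - 2 ^ j"
    and A: "A \<subseteq> X"
  shows "(\<exists>c. (c = 1 \<or> c = - 1) \<and> (\<forall>B\<in>S. walsh A B = c)) \<or>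
    (\<exists>a\<le>Suc m. \<bar>\<Sum>B\<in>S. walsh A B\<bar> = 2 ^ a - e \<and> e < 2 ^ a)"
proof (rule disj_imp [THEN iffD2], rule impI)
  assume nc: "\<not> (\<exists>c. (c = 1 \<or> c = - 1) \<and> (\<forall>B\<in>S. walsh A B = c))"
  define g where "g = (\<Sum>B\<in>S. walsh A B)"
  \<comment> \<open>Opposing the sign of \<open>g\<close> selects the smaller half, of size (|S| -
    |g|) / 2, which is small enough for \<open>IH\<close>.\<close>
  define c :: int where "c = (if g \<ge> 0 then - 1 else 1)"
  define H where "H = {B \<in> S. walsh A B = c}"
  have finS: "finite S" using fin by (simp add: finite_subset)
  have c: "c = 1 \<or> c = - 1" by (simp add: c_def)
  have cH: "2 * int (card H) = int (card S) - \<bar>g\<bar>"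
    using card_walsh_half[OF finS c, of A] by (auto simp: H_def g_def c_def)
  obtain B where "B \<in> S" "walsh A B \<noteq> - c"
    using nc c by (metis minus_minus)
  then have "H \<noteq> {}"
    using walsh_cases[of A B] c by (auto simp: H_def)
  moreover have "even_cover m X H"
    unfolding H_def using even_cover_half[OF fin(1) finS A even c] .
  moreover have "card H < 2 ^ Suc m"
    using cH small by simp
  ultimately obtain j where j: "j \<le> m" "int (card H) = 2 ^ Suc m - 2 ^ j"
    using IH[of H] by (auto simp: H_def)
  then have "\<bar>g\<bar> = 2 ^ Suc j - e"
    using cH e(1) by simp
  \<comment> \<open>This excludes \<open>g = 0\<close>, so that \<open>2 ^ a - e\<close> is positive
    and not merely nonnegative.\<close>
  moreover have "e \<noteq> 2 ^ Suc j" using j e(2) by blast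
  ultimately show "\<exists>a\<le>Suc m. \<bar>\<Sum>B\<in>S. walsh A B\<bar> = 2 ^ a - e \<and> e < 2 ^ a"
    using j(1) abs_ge_zero[of g] unfolding g_def[symmetric]
    by (intro exI[of _ "Suc j"] conjI; linarith)
qed

text \<open>The constant value factors out of the sum, and it is the sign of the sum over
  \<open>walsh A\<close> because \<open>S\<close> is nonempty.\<close>

lemma sgn_sum_walsh_sym_diff_of_const:
  assumes finS: "finite S" "S \<noteq> {}" and A: "finite A" "finite C"
    and const: "\<exists>c. (c = 1 \<or> c = - 1) \<and> (\<forall>B\<in>S. walsh A B = c)"
  shows "sgn (\<Sum>B\<in>S. walsh (sym_diff A C) B) = sgn (\<Sum>B\<in>S. walsh A B) * sgn (\<Sum>B\<in>S. walsh C B)"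
proof -
  obtain c where c: "c = 1 \<or> c = - 1" "\<And>B. B \<in> S \<Longrightarrow> walsh A B = c" using const by blast
  have "(\<Sum>B\<in>S. walsh (sym_diff A C) B) = c * (\<Sum>B\<in>S. walsh C B)"
    using c(2) A by (simp add: walsh_sym_diff sum_distrib_left)
  moreover have "(\<Sum>B\<in>S. walsh A B) = c * int (card S)" using c(2) by simp
  moreover have "card S > 0" using finS by (simp add: card_gt_0_iff)
  ultimately show ?thesis using c(1) by (auto simp: sgn_mult)
qed

section \<open>Sizes of even covers below twice the minimum distance\<close>

lemma even_cover_card:
  assumes "finite X" "S \<subseteq> Pow X" "even_cover n X S" "S \<noteq> {}" "card S < 2 ^ Suc n"
  shows "\<exists>j\<le>n. int (card S) = 2 ^ Suc n - 2 ^ j"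
  using assms(2-)
proof (induction n arbitrary: S rule: less_induct)
  case (less n)
  have finS: "finite S" using less.prems(1) assms(1) by (simp add: finite_subset)
  then have pos: "card S > 0" using less.prems by (simp add: card_gt_0_iff)
  have ev: "even (card S)" if "n > 0"
    using less.prems(2) that unfolding even_cover_def by (auto dest: spec[of _ "{}"])
  \<comment> \<open>Two base cases, since the induction step descends to both \<open>n - 1\<close>
    (halves) and \<open>n - 2\<close> (quarters).\<close>
  consider "n = 0" | "n = 1" | m where "n = Suc (Suc m)"
    by (metis One_nat_def not0_implies_Suc)
  then show ?case
  proof cases
    case 1
    then show ?thesis using less.prems(4) pos by simp
  next
    case 2
    then have "even (card S)" "card S < 4" using ev less.prems(4) by simp_all
    then have "card S = 2" using pos by presburger
    then show ?thesis using 2 by (intro exI[of _ 1]) simp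
  next
    case 3
    show ?thesis
    proof (rule ccontr)
      assume neg: "\<not> ?thesis"
      define e where "e = 2 ^ Suc n - int (card S)"
      define g where "g A = (\<Sum>B\<in>S. walsh A B)" for A
      have "int (card S) < 2 ^ Suc n"
        using less.prems(4) by (metis of_nat_less_iff of_nat_numeral of_nat_power)
      then have e0: "0 < e" by (simp add: e_def)
      have enp: "e \<noteq> 2 ^ j" if "j \<le> n" for j
        using neg that by (auto simp: e_def)
      have finA: "finite A" if "A \<subseteq> X" for A using that assms(1) by (rule finite_subset)
      let ?const = "\<lambda>A. \<exists>c. (c = 1 \<or> c = - 1) \<and> (\<forall>B\<in>S. walsh A B = c)"
      have dich: "?const A \<or> (\<exists>a\<le>n. \<bar>g A\<bar> = 2 ^ a - e \<and> e < 2 ^ a)" if "A \<subseteq> X" for A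
        unfolding g_def 3
      proof (rule abs_sum_walsh_dichotomy)
        fix H assume "H \<subseteq> S" "even_cover (Suc m) X H" "H \<noteq> {}" "card H < 2 ^ Suc (Suc m)"
        then show "\<exists>j\<le>Suc m. int (card H) = 2 ^ Suc (Suc m) - 2 ^ j"
          using less.IH[of "Suc m" H] less.prems(1) 3 by auto
      qed (use assms(1) less.prems that 3 enp e_def in auto)
      have nz: "g A \<noteq> 0" if "A \<subseteq> X" for A
        using dich[OF that] pos by (auto simp: g_def)
      have sgn_g_mult: "sgn (g (sym_diff A C)) = sgn (g A) * sgn (g C)"
        if AC: "A \<subseteq> X" "C \<subseteq> X" for A C
      proof -
        \<comment> \<open>Each of \<open>A\<close>, \<open>C\<close>, \<open>D\<close> is the
          symmetric difference of the other two, so whichever character is constant can be the one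
          factored out.\<close>
        define D where "D = sym_diff A C"
        have D: "D \<subseteq> X" and D': "sym_diff A D = C" "sym_diff C D = A" "sym_diff C A = D"
          using AC by (auto simp: D_def)
        have sgn_cases: "sgn (g E) = 1 \<or> sgn (g E) = - 1" if "E \<subseteq> X" for E
          using nz[OF that] by (auto simp: sgn_if)
        note * = sgn_sum_walsh_sym_diff_of_const[OF finS less.prems(3), folded g_def]
        consider "?const A" | "?const C" | "?const D" | "\<not> ?const A" "\<not> ?const C" "\<not> ?const D"
          by blast
        then have "sgn (g D) = sgn (g A) * sgn (g C)"
        proof cases
          case 1
          then show ?thesis using *[of A C] AC finA D_def by simp
        next
          case 2
          then show ?thesis using *[of C A] AC finA D' by (simp add: mult.commute)
        next
          case 3
          then have "sgn (g A) = sgn (g D) * sgn (g C)"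
            using *[of D C] AC D finA D' by (simp add: Un_commute)
          then show ?thesis using sgn_cases[OF AC(2)] by auto
        next
          case 4
          then obtain a b d where abd: "a \<le> n" "b \<le> n" "d \<le> n"
            "\<bar>g A\<bar> = 2 ^ a - e" "\<bar>g C\<bar> = 2 ^ b - e" "\<bar>g D\<bar> = 2 ^ d - e"
            "e < 2 ^ a" "e < 2 ^ b" "e < 2 ^ d"
            using dich AC D by meson
          show ?thesis
          proof (rule ccontr)
            assume ne: "sgn (g D) \<noteq> sgn (g A) * sgn (g C)"
            \<comment> \<open>The quarter of \<open>S\<close> in which all three characters oppose the signs of their sums.\<close>
            define P where "P = {B \<in> {B \<in> S. walsh A B = - sgn (g A)}. walsh C B = - sgn (g C)}"
            have sg: "sgn (g A) * sgn (g C) = - sgn (g D)"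
              using ne sgn_cases AC D by (metis minus_minus mult_minus1 mult_1)
            have c: "- sgn (g A) = 1 \<or> - sgn (g A) = - 1" "- sgn (g C) = 1 \<or> - sgn (g C) = - 1"
              using sgn_cases[OF AC(1)] sgn_cases[OF AC(2)] by auto
            have "4 * int (card P) = int (card S) - sgn (g A) * g A - sgn (g C) * g C
                + (sgn (g A) * sgn (g C)) * g D"
              using card_walsh_quarter[OF finS c finA[OF AC(1)] finA[OF AC(2)]]
              by (simp add: P_def g_def D_def)
            \<comment> \<open>By \<open>sg\<close> all three sums enter as minus their absolute
              values; the three terms \<open>e\<close> from these and the \<open>- e\<close> in
              \<open>card S\<close> leave \<open>2 * e\<close>.\<close>
            then have cP: "4 * int (card P) = 2 ^ Suc n + 2 * e - (2 ^ a + 2 ^ b + 2 ^ d)"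
              using abd by (simp only: sg abs_sgn mult.commute e_def mult_minus_left) simp
            have "even_cover m X P" unfolding P_def
            proof (intro even_cover_half)
              show "even_cover (Suc (Suc m)) X S" using less.prems(2) 3 by simp
            qed (use assms(1) finS AC c in auto)
            moreover have "card P < 2 ^ Suc m"
            proof -
              have "4 * int (card P) < 4 * 2 ^ Suc m" using cP abd(7-9) e0 3 by simp
              then have "int (card P) < int (2 ^ Suc m)" by simp
              then show ?thesis by (simp only: of_nat_less_iff)
            qed
            moreover have "P \<subseteq> Pow X" using less.prems(1) by (auto simp: P_def)
            ultimately have "P = {} \<or> (\<exists>j\<le>m. int (card P) = 2 ^ Suc m - 2 ^ j)"
              using less.IH[of m P] 3 by auto
            \<comment> \<open>An empty quarter has the same form, with \<open>l = Suc n\<close>;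
              otherwise \<open>l = j + 2\<close>, because \<open>n = m + 2\<close>.\<close>
            then obtain l where "4 * int (card P) = 2 ^ Suc n - 2 ^ l"
            proof (elim disjE exE conjE)
              assume "P = {}"
              then show thesis by (intro that[of "Suc n"]) simp
            next
              fix j assume "int (card P) = 2 ^ Suc m - 2 ^ j"
              then show thesis using 3 by (intro that[of "Suc (Suc j)"]) simp
            qed
            then have "2 ^ a + 2 ^ b + 2 ^ d = 2 * e + 2 ^ l" using cP by simp
            then obtain j where "j < max a (max b d)" "e = 2 ^ j"
              using power_two_sum_three[OF e0 abd(7-9)] by blast
            then show False using enp[of j] abd(1-3) by simp
          qed
        qed
        then show ?thesis by (simp add: D_def)
      qed
      \<comment> \<open>\<open>sgn (g A)\<close> is a character, so it agrees with \<open>A \<mapsto> walsh A B\<close> for at most one \<open>B\<close>,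
        and orthogonality bounds the sum of all \<open>\<bar>g A\<bar>\<close>.\<close>
      define U where "U = {B \<in> S. \<forall>A\<subseteq>X. sgn (g A) * walsh A B = 1}"
      \<comment> \<open>The characters of singletons \<open>{x}\<close> already determine which
        points lie in \<open>B\<close>.\<close>
      have "B = B'" if "B \<in> U" "B' \<in> U" for B B'
      proof (rule set_eqI)
        fix x
        show "x \<in> B \<longleftrightarrow> x \<in> B'"
        proof (cases "x \<in> X")
          case True
          then have "sgn (g {x}) * walsh {x} B = sgn (g {x}) * walsh {x} B'"
            using that by (simp add: U_def)
          then show ?thesis using nz[of "{x}"] True
            by (auto simp: walsh_singleton sgn_eq_0_iff split: if_splits)
        next
          case False
          then show ?thesis using that less.prems(1) by (auto simp: U_def)
        qed
      qed
      moreover have finU: "finite U" using finS by (simp add: U_def)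
      ultimately have cU: "card U \<le> 1"
        by (simp add: card_le_Suc0_iff_eq)
      have inner: "(\<Sum>A\<in>Pow X. sgn (g A) * walsh A B) = (if B \<in> U then 2 ^ card X else 0)"
        if B: "B \<in> S" for B
      proof (cases "B \<in> U")
        case True
        then have "(\<Sum>A\<in>Pow X. sgn (g A) * walsh A B) = (\<Sum>A\<in>Pow X. 1)"
          by (intro sum.cong) (auto simp: U_def)
        then show ?thesis using True assms(1) by (simp add: card_Pow)
      next
        case False
        then obtain C where C: "C \<subseteq> X" "sgn (g C) * walsh C B \<noteq> 1" using B by (auto simp: U_def)
        then have "sgn (g C) * walsh C B = - 1"
          using nz[OF C(1)] walsh_cases[of C B] by (auto simp: sgn_if split: if_splits)
        then have "(\<Sum>A\<in>Pow X. sgn (g A) * walsh A B) = 0"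
          using C(1)
          by (intro sum_character_Pow_eq_0[where C = C])
            (simp_all add: sgn_g_mult walsh_sym_diff finA)
        then show ?thesis using False by simp
      qed
      have "(\<Sum>A\<in>Pow X. \<bar>g A\<bar>) = (\<Sum>A\<in>Pow X. \<Sum>B\<in>S. sgn (g A) * walsh A B)"
        by (intro sum.cong refl) (simp add: abs_sgn g_def sum_distrib_right mult.commute)
      also have "\<dots> = (\<Sum>B\<in>S. \<Sum>A\<in>Pow X. sgn (g A) * walsh A B)"
        by (rule sum.swap)
      also have "\<dots> = (\<Sum>B\<in>S. if B \<in> U then 2 ^ card X else 0)"
        using inner by (intro sum.cong) simp_all
      also have "\<dots> = int (card (S \<inter> U)) * 2 ^ card X"
        using finS by (simp add: sum.If_cases Int_def)
      also have "S \<inter> U = U" by (auto simp: U_def)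
      also have "int (card U) * 2 ^ card X \<le> 1 * 2 ^ card X"
        using cU by (intro mult_right_mono) simp_all
      finally have "(\<Sum>A\<in>Pow X. \<bar>g A\<bar>) \<le> 2 ^ card X" by (simp only: mult_1)
      moreover have "(\<Sum>A\<in>Pow X. 1) < (\<Sum>A\<in>Pow X. \<bar>g A\<bar>)"
      proof (rule sum_strict_mono_ex1)
        show "\<forall>A\<in>Pow X. 1 \<le> \<bar>g A\<bar>"
        proof
          fix A assume "A \<in> Pow X"
          then have "g A \<noteq> 0" using nz by blast
          then show "1 \<le> \<bar>g A\<bar>" by linarith
        qed
        have "card S \<ge> 2" using pos ev 3 by (cases "card S = 1") simp_all
        then show "\<exists>A\<in>Pow X. 1 < \<bar>g A\<bar>" by (intro bexI[of _ "{}"]) (simp_all add: g_def)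
      qed (use assms(1) in simp)
      ultimately show False using assms(1) by (simp add: card_Pow)
    qed
  qed
qed

section \<open>From Steiner trades to even covers\<close>

text \<open>A trade balances only the \<open>t\<close>-sets, while \<open>even_cover\<close>
  concerns all smaller sets too. Descend in \<open>card A\<close>: counting pairs of a block
  containing \<open>A\<close> and a point of it outside \<open>A\<close> expresses
  \<open>k - card A\<close> times the count for \<open>A\<close> through the counts for the sets
  \<open>insert x A\<close>.\<close>

lemma card_superset_eq_of_regular:
  assumes "finite X" "S \<subseteq> nsets X k" "S' \<subseteq> nsets X k" "t \<le> k"
    and eq: "\<And>A. A \<in> nsets X t \<Longrightarrow> card {B \<in> S. A \<subseteq> B} = card {B \<in> S'. A \<subseteq> B}"
    and "A \<subseteq> X" "card A \<le> t"
  shows "card {B \<in> S. A \<subseteq> B} = card {B \<in> S'. A \<subseteq> B}"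
  using assms(6,7)
proof (induction "t - card A" arbitrary: A)
  case 0
  then show ?case using assms(1) by (intro eq) (auto simp: nsets_def finite_subset)
next
  case (Suc d)
  have finA: "finite A" using Suc.prems assms(1) by (auto intro: finite_subset)
  have count: "(\<Sum>x\<in>X - A. card {B \<in> R. insert x A \<subseteq> B}) = (k - card A) * card {B \<in> R. A \<subseteq> B}"
    if R: "R \<subseteq> nsets X k" for R
  proof -
    have "finite R" using R assms(1) by (meson finite_imp_finite_nsets finite_subset)
    then have "(\<Sum>x\<in>X - A. card {B \<in> {B \<in> R. A \<subseteq> B}. x \<in> B})
        = (\<Sum>B\<in>{B \<in> R. A \<subseteq> B}. card {x \<in> X - A. x \<in> B})"
      using assms(1) by (intro sum_multicount_gen) auto
    also have "\<dots> = (\<Sum>B\<in>{B \<in> R. A \<subseteq> B}. k - card A)"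
    proof (intro sum.cong refl)
      fix B assume B: "B \<in> {B \<in> R. A \<subseteq> B}"
      then have "{x \<in> X - A. x \<in> B} = B - A" using R by (auto simp: nsets_def)
      then show "card {x \<in> X - A. x \<in> B} = k - card A"
        using B R finA by (auto simp: card_Diff_subset nsets_def)
    qed
    finally show ?thesis by (simp add: conj_ac)
  qed
  have "card {B \<in> S. insert x A \<subseteq> B} = card {B \<in> S'. insert x A \<subseteq> B}" if "x \<in> X - A" for x
    using that Suc.prems Suc.hyps finA by (intro Suc.hyps(1)) auto
  then have "(k - card A) * card {B \<in> S. A \<subseteq> B} = (k - card A) * card {B \<in> S'. A \<subseteq> B}"
    unfolding count[OF assms(2), symmetric] count[OF assms(3), symmetric] by (intro sum.cong) auto
  moreover have "k - card A \<noteq> 0" using Suc.hyps(2) assms(4) by linarith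
  ultimately show ?case by simp
qed

text \<open>Every block contains some \<open>t\<close>-set, whose cover count bounds the
  multiplicity of the block. Thus the sides of a Steiner trade may be treated as sets.\<close>

lemma mset_set_set_mset_of_cover_le_1:
  assumes "set_mset M \<subseteq> nsets X k" "t \<le> k" "\<And>A. A \<in> nsets X t \<Longrightarrow> cover_count M A \<le> 1"
  shows "mset_set (set_mset M) = M"
proof (rule multiset_eqI)
  fix B
  show "count (mset_set (set_mset M)) B = count M B"
  proof (cases "B \<in># M")
    case True
    then have B: "B \<subseteq> X" "finite B" "card B = k" using assms(1) by (auto simp: nsets_def)
    then obtain A where A: "A \<subseteq> B" "card A = t" "finite A"
      using assms(2) by (metis obtain_subset_with_card_n)
    then have "count M B = count (filter_mset (\<lambda>B. A \<subseteq> B) M) B" by simp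
    also have "\<dots> \<le> cover_count M A" unfolding cover_count_def by (rule count_le_size)
    also have "\<dots> \<le> 1" using A B by (intro assms(3)) (auto simp: nsets_def)
    finally show ?thesis using True by (simp add: le_antisym)
  qed (simp add: not_in_iff)
qed

lemma steiner_trade_volume:
  assumes "finite X" "t < k" "steiner_trade t k X T" "0 < volume T" "volume T < 2 ^ (t + 1)"
  shows "\<exists>j\<le>t + 1. 2 * int (volume T) = 2 ^ (t + 2) - 2 ^ j"
proof -
  define M where "M = fst T"
  define M' where "M' = snd T"
  define S where "S = set_mset M"
  define S' where "S' = set_mset M'"
  have tr: "trade t k X T" using assms(3) by (simp add: steiner_trade_def)
  have sub: "S \<subseteq> nsets X k" "S' \<subseteq> nsets X k" "S \<inter> S' = {}"
    using tr by (auto simp: trade_def S_def S'_def M_def M'_def)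
  have M: "mset_set S = M" "mset_set S' = M'"
    using assms(2,3) sub unfolding S_def S'_def
    by (auto intro!: mset_set_set_mset_of_cover_le_1[of _ X k t]
        simp: steiner_trade_def M_def M'_def)
  have fin: "finite S" "finite S'" by (simp_all add: S_def S'_def)
  have cov: "cover_count M A = card {B \<in> S. A \<subseteq> B}" "cover_count M' A = card {B \<in> S'. A \<subseteq> B}" for A
    unfolding cover_count_def using fin by (simp_all flip: M add: filter_mset_mset_set)
  have "card S = volume T" using M(1) unfolding volume_def M_def by (metis size_mset_set)
  moreover have "card S' = volume T"
    using trade_size_eq[OF assms(1) _ tr] assms(2) M(2) unfolding volume_def M'_def
    by (metis size_mset_set less_imp_le)
  ultimately have cSS: "card (S \<union> S') = 2 * volume T"
    using fin sub(3) by (simp add: card_Un_disjoint)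
  \<comment> \<open>The two sides are disjoint and balanced, so each count in the union is twice the
    count in one side.\<close>
  have "even_cover (t + 1) X (S \<union> S')"
    unfolding even_cover_def
  proof (intro allI impI)
    fix A assume A: "A \<subseteq> X" "card A < t + 1"
    have "card {B \<in> S. A \<subseteq> B} = card {B \<in> S'. A \<subseteq> B}"
    proof (rule card_superset_eq_of_regular[OF assms(1) sub(1,2)])
      show "card {B \<in> S. C \<subseteq> B} = card {B \<in> S'. C \<subseteq> B}" if "C \<in> nsets X t" for C
        using tr that by (simp add: trade_def flip: cov M_def M'_def)
    qed (use assms(2) A in auto)
    moreover have "card {B \<in> S \<union> S'. A \<subseteq> B} = card {B \<in> S. A \<subseteq> B} + card {B \<in> S'. A \<subseteq> B}"
      using fin sub(3) by (subst card_Un_disjoint [symmetric]) (auto intro!: arg_cong [where f = card])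
    ultimately show "even (card {B \<in> S \<union> S'. A \<subseteq> B})" by simp
  qed
  moreover have "S \<union> S' \<noteq> {}" "S \<union> S' \<subseteq> Pow X"
    using cSS assms(4) sub by (auto simp: nsets_def)
  ultimately show ?thesis
    using even_cover_card[OF assms(1), of "S \<union> S'" "t + 1"] cSS assms(5) by simp
qed

theorem mainTheorem2:
  fixes t k v i s :: nat and X :: "'a set"
  assumes "0 < t" and "t < k" and "k < v"
    and "finite X" and "card X = v"
    and "i < t"
    and "2 ^ (t + 1) - 2 ^ (t - i) < s"
    and "s < 2 ^ (t + 1) - 2 ^ (t - (i + 1))"
  shows "\<not> (\<exists>T. steiner_trade t k X T \<and> volume T = s)"
proof
  assume "\<exists>T. steiner_trade t k X T \<and> volume T = s"
  then obtain T where T: "steiner_trade t k X T" "volume T = s" by blast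
  have "0 < volume T" "volume T < 2 ^ (t + 1)" using assms(7,8) T(2) by linarith+
  from steiner_trade_volume[OF assms(4,2) T(1) this]
  obtain j where j: "2 * int s = 2 ^ (t + 2) - 2 ^ j" using T(2) by auto
  define p where "p = t - (i + 1)"
  have p: "t - i = Suc p" "t - (i + 1) = p" using assms(6) by (simp_all add: p_def)
  \<comment> \<open>These bounds make the truncated subtractions in the hypotheses on
    \<open>s\<close> exact.\<close>
  have "(2::nat) ^ Suc p \<le> 2 ^ (t + 1)" "(2::nat) ^ p \<le> 2 ^ (t + 1)"
    by (rule power_increasing; simp add: p_def)+
  then have "2 ^ (t + 1) < s + 2 ^ Suc p" "s + 2 ^ p < 2 ^ (t + 1)"
    using assms(7,8) unfolding p by linarith+
  then have "2 ^ (t + 1) < int s + 2 ^ Suc p" "int s + 2 ^ p < 2 ^ (t + 1)"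
    by (simp_all flip: of_nat_less_iff[where 'a = int])
  \<comment> \<open>Doubling the inequalities and inserting \<open>j\<close> places
    \<open>2 ^ j\<close> strictly between two consecutive powers of 2.\<close>
  then have "(2::int) ^ j < 2 ^ Suc (Suc p)" "(2::int) ^ Suc p < 2 ^ j"
    using j by simp_all
  then have "j < Suc (Suc p)" "Suc p < j"
    by (simp_all only: power_strict_increasing_iff[of "2::int"] one_less_numeral_iff semiring_norm)
  then show False by simp
qed

end
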